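(* The real spectral region of the $4$-cycle stochastic matrices, i.e. the set of all real $\lambda$ such that $\lambda$ is an eigenvalue of $A(\alpha_1,\alpha_2,\alpha_3,\alpha_4)$ for some $\alpha_1,\alpha_2,\alpha_3,\alpha_4\in[0,1)$, is exactly the interval $[-1,1]$.
   Context: For $\alpha_1,\alpha_2,\alpha_3,\alpha_4\in[0,1)$, the $4$-cycle stochastic matrix is $$A(\alpha_1,\alpha_2,\alpha_3,\alpha_4)=\begin{pmatrix}\alpha_1&1-\alpha_1&0&0\\0&\alpha_2&1-\alpha_2&0\\0&0&\alpha_3&1-\alpha_3\\1-\alpha_4&0&0&\alpha_4\end{pmatrix}.$$ *)

theory Defs
  imports Complex_Main "Jordan_Normal_Form.Char_Poly"
begin

definition four_cycle_matrix :: "real \<Rightarrow> real \<Rightarrow> real \<Rightarrow> real \<Rightarrow> real mat" where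
  "four_cycle_matrix a1 a2 a3 a4 = mat_of_rows_list 4
     [[a1,     1 - a1, 0,      0     ],
      [0,      a2,     1 - a2, 0     ],
      [0,      0,      a3,     1 - a3],
      [1 - a4, 0,      0,      a4    ]]"

definition real_spectral_region :: "real set" where
  "real_spectral_region =
     {x. \<exists>a1 a2 a3 a4. a1 \<in> {0..<1} \<and> a2 \<in> {0..<1} \<and> a3 \<in> {0..<1} \<and> a4 \<in> {0..<1} \<and>
           eigenvalue (four_cycle_matrix a1 a2 a3 a4) x}"

end

theory Submission
  imports Defs
begin

text \<open>A real eigenvalue of a stochastic matrix has modulus at most \<open>1\<close>: compare both sides of the
  eigenvalue equation in a coordinate where the eigenvector is largest. Conversely, if all four
  parameters equal \<open>a\<close>, the matrix is \<open>a I + (1 - a) P\<close> with \<open>P\<close> the cyclic shift. The alternating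
  vector is an eigenvector of \<open>P\<close> for \<open>-1\<close>, because the length of the cycle is even, so \<open>a I + (1 - a) P\<close>
  has the eigenvalue \<open>2 a - 1\<close>. As \<open>a\<close> runs through \<open>[0, 1)\<close> this sweeps out \<open>[-1, 1)\<close>, and the
  missing endpoint \<open>1\<close> has the constant vector as eigenvector.\<close>

text \<open>In a row \<open>i\<close> where \<open>\<bar>v\<^sub>i\<bar>\<close> is maximal, the triangle inequality gives
  \<open>\<bar>x\<bar> \<bar>v\<^sub>i\<bar> \<le> c \<bar>v\<^sub>i\<bar>\<close>, and \<open>v\<^sub>i\<close> does not vanish.\<close>
lemma abs_eigenvalue_le_row_sum:
  fixes A :: "real mat"
  assumes A: "A \<in> carrier_mat n n" and ev: "eigenvalue A x"
    and rows: "\<And>i. i < n \<Longrightarrow> (\<Sum>j<n. \<bar>A $$ (i, j)\<bar>) \<le> c"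
  shows "\<bar>x\<bar> \<le> c"
proof -
  from ev obtain v where v: "v \<in> carrier_vec n" "v \<noteq> 0\<^sub>v n" "A *\<^sub>v v = x \<cdot>\<^sub>v v"
    using A by (auto simp: eigenvalue_def eigenvector_def)
  then obtain k where k: "k < n" "v $ k \<noteq> 0"
    by (metis carrier_vecD eq_vecI index_zero_vec)
  have "finite ((\<lambda>i. \<bar>v $ i\<bar>) ` {..<n})" "(\<lambda>i. \<bar>v $ i\<bar>) ` {..<n} \<noteq> {}"
    using k by auto
  from Max_in[OF this] obtain i
    where i: "i < n" and "Max ((\<lambda>i. \<bar>v $ i\<bar>) ` {..<n}) = \<bar>v $ i\<bar>"
    by auto
  then have i_max: "\<bar>v $ j\<bar> \<le> \<bar>v $ i\<bar>" if "j < n" for j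
    using that Max_ge[of "(\<lambda>i. \<bar>v $ i\<bar>) ` {..<n}" "\<bar>v $ j\<bar>"] by simp
  have "x * v $ i = (A *\<^sub>v v) $ i"
    using v i by simp
  also have "\<dots> = (\<Sum>j<n. A $$ (i, j) * v $ j)"
    using A v(1) i by (auto simp: scalar_prod_def atLeast0LessThan)
  finally have "\<bar>x\<bar> * \<bar>v $ i\<bar> = \<bar>\<Sum>j<n. A $$ (i, j) * v $ j\<bar>"
    by (simp flip: abs_mult)
  also have "\<dots> \<le> (\<Sum>j<n. \<bar>A $$ (i, j)\<bar> * \<bar>v $ j\<bar>)"
    by (rule order_trans[OF sum_abs]) (simp add: abs_mult)
  also have "\<dots> \<le> (\<Sum>j<n. \<bar>A $$ (i, j)\<bar> * \<bar>v $ i\<bar>)"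
    by (intro sum_mono mult_left_mono) (auto intro: i_max)
  also have "\<dots> \<le> c * \<bar>v $ i\<bar>"
    using rows[OF i] by (simp add: mult_right_mono flip: sum_distrib_right)
  finally have "\<bar>x\<bar> * \<bar>v $ i\<bar> \<le> c * \<bar>v $ i\<bar>" .
  moreover have "0 < \<bar>v $ i\<bar>"
    using i_max[OF k(1)] k(2) by linarith
  ultimately show ?thesis
    by (rule mult_right_le_imp_le)
qed

lemma four_cycle_matrix_carrier: "four_cycle_matrix a1 a2 a3 a4 \<in> carrier_mat 4 4"
  by (rule carrier_matI) (simp_all add: four_cycle_matrix_def mat_of_rows_list_def)

lemma four_cycle_matrix_row_sum:
  assumes "a1 \<in> {0..<1}" "a2 \<in> {0..<1}" "a3 \<in> {0..<1}" "a4 \<in> {0..<1}" and "i < 4"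
  shows "(\<Sum>j<4. \<bar>four_cycle_matrix a1 a2 a3 a4 $$ (i, j)\<bar>) = 1"
proof -
  have "{..<4} = {0, 1, 2, 3::nat}" by auto
  moreover from \<open>i < 4\<close> have "i = 0 \<or> i = 1 \<or> i = 2 \<or> i = 3" by auto
  ultimately show ?thesis
    using assms(1-4)
    by (elim disjE) (simp_all add: four_cycle_matrix_def mat_of_rows_list_def)
qed

text \<open>The two real eigenvectors of the cyclic shift, \<open>s = 1\<close> giving the constant and \<open>s = -1\<close> the
  alternating one.\<close>
lemma eigenvalue_four_cycle_matrix_equal:
  assumes "s * s = 1"
  shows "eigenvalue (four_cycle_matrix a a a a) (a + (1 - a) * s)"
proof -
  have four: "{0..<4} = {0, 1, 2, 3::nat}" by auto
  let ?v = "vec 4 (\<lambda>i. if even i then 1 else s)"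
  have "four_cycle_matrix a a a a *\<^sub>v ?v = (a + (1 - a) * s) \<cdot>\<^sub>v ?v"
  proof (rule eq_vecI)
    fix i assume "i < dim_vec ((a + (1 - a) * s) \<cdot>\<^sub>v ?v)"
    then have "i = 0 \<or> i = 1 \<or> i = 2 \<or> i = 3" by auto
    moreover have "a * s + (1 - a) = (a + (1 - a) * s) * s"
      "(1 - a) + a * s = (a + (1 - a) * s) * s"
      using assms by (simp_all add: distrib_right mult.assoc)
    ultimately show "(four_cycle_matrix a a a a *\<^sub>v ?v) $ i = ((a + (1 - a) * s) \<cdot>\<^sub>v ?v) $ i"
      using four by (elim disjE)
        (simp_all add: four_cycle_matrix_def mat_of_rows_list_def scalar_prod_def)
  qed (simp add: four_cycle_matrix_def mat_of_rows_list_def)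
  moreover have "?v \<noteq> 0\<^sub>v 4"
  proof
    assume "?v = 0\<^sub>v 4"
    then have "?v $ 0 = 0\<^sub>v 4 $ 0" by (rule arg_cong)
    then show False by simp
  qed
  moreover have "?v \<in> carrier_vec 4" by (rule vec_carrier)
  moreover have "dim_row (four_cycle_matrix a a a a) = 4"
    by (rule carrier_matD(1)[OF four_cycle_matrix_carrier])
  ultimately show ?thesis
    unfolding eigenvalue_def eigenvector_def by (intro exI[of _ ?v]) (simp only: simp_thms)
qed

theorem theorem3p3:
  shows "real_spectral_region = {-1..1}"
proof (intro equalityI subsetI)
  fix x assume "x \<in> real_spectral_region"
  then obtain a1 a2 a3 a4
    where a: "a1 \<in> {0..<1}" "a2 \<in> {0..<1}" "a3 \<in> {0..<1}" "a4 \<in> {0..<1}"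
      and ev: "eigenvalue (four_cycle_matrix a1 a2 a3 a4) x"
    unfolding real_spectral_region_def by blast
  have "\<bar>x\<bar> \<le> 1"
    by (rule abs_eigenvalue_le_row_sum[OF four_cycle_matrix_carrier ev])
      (simp add: four_cycle_matrix_row_sum[OF a])
  then show "x \<in> {-1..1}" by auto
next
  fix x :: real assume x: "x \<in> {-1..1}"
  have "\<exists>a\<in>{0..<1}. eigenvalue (four_cycle_matrix a a a a) x"
  proof (cases "x = 1")
    case True
    then show ?thesis
      using eigenvalue_four_cycle_matrix_equal[of 1 0] by (intro bexI[of _ 0]) simp_all
  next
    case False
    \<comment> \<open>Solve \<open>2 a - 1 = x\<close> for \<open>a\<close>.\<close>
    let ?a = "(1 + x) / 2"
    have "?a \<in> {0..<1}" using x False by auto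
    moreover have "?a + (1 - ?a) * (- 1) = x" by (simp add: field_simps)
    ultimately show ?thesis
      using eigenvalue_four_cycle_matrix_equal[of "- 1" ?a] by auto
  qed
  then show "x \<in> real_spectral_region"
    unfolding real_spectral_region_def by blast
qed

end
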